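(* Let $n\ge 3$, $R>0$, let $0=x_1=r_1<x_2=r_2<\dots<x_n=r_n=R$ be a (possibly nonuniform) mesh, let $q:[0,R]\to\mathbb{R}$, and put $q_i=q(x_i)$. Let $k_1,\dots,k_n$ be the numerical solution, by the first generalized quadrature method, of the Abel equation $$2\int_x^R\frac{r}{\sqrt{r^2-x^2}}\,k(r)\,dr=q(x),\qquad 0\le x\le R .$$ Then $k_1,\dots,k_n$ are given by the recursion $$k_{n-1}=\frac{q_{n-1}/2}{p_{n-1,n-1}},$$ $$k_i=\frac{q_i/2-\sum_{j=i+1}^{n-1}p_{ij}k_j}{p_{ii}},\qquad i=n-2,n-3,\dots,1,$$ $$k_n=k_{n-2}+\left(\frac{r_n-r_{n-2}}{r_{n-1}-r_{n-2}}\right)(k_{n-1}-k_{n-2}),$$ where $$p_{ij}=\sqrt{r_{j+1}^2-x_i^2}-\sqrt{r_j^2-x_i^2},\qquad 1\le i\le j\le n-1 .$$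
   Context: First generalized quadrature method (generalized left rectangles): the unknown function is approximated by the step function $\widetilde k$ with $\widetilde k(r)=k_j$ for $r\in[r_j,r_{j+1})$, $j=1,\dots,n-1$, and the numbers $k_1,\dots,k_{n-1}$ are required to satisfy the Abel equation with $k$ replaced by $\widetilde k$ at the nodes $x=x_i$, $i=1,\dots,n-1$: $$2\int_{x_i}^R\frac{r}{\sqrt{r^2-x_i^2}}\,\widetilde k(r)\,dr=q_i,\qquad i=1,\dots,n-1 .$$ The remaining value $k_n$ (approximating $k(R)$) is not determined by these equations and is defined by linear extrapolation: it is the value at $r_n$ of the affine function through the points $(r_{n-2},k_{n-2})$ and $(r_{n-1},k_{n-1})$. Integrals with a singularity at an endpoint are convergent improper integrals. *)

theory Defs
  imports "HOL-Analysis.Analysis"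
begin

text \<open>Improper integral over \<open>(a, b]\<close> of a function that may be singular at the left
  endpoint \<open>a\<close>: the one-sided limit of the proper integrals over \<open>[c, b]\<close> as \<open>c\<close> decreases
  to \<open>a\<close>. Convergence is part of the predicate.\<close>

definition has_improper_integral ::
  "(real \<Rightarrow> real) \<Rightarrow> real \<Rightarrow> real \<Rightarrow> real \<Rightarrow> bool" where
  "has_improper_integral f a b I \<longleftrightarrow>
     (\<forall>c. a < c \<and> c < b \<longrightarrow> f integrable_on {c..b}) \<and>
     ((\<lambda>c. integral {c..b} f) \<longlongrightarrow> I) (at_right a)"

definition abel_equation_at ::
  "real \<Rightarrow> (real \<Rightarrow> real) \<Rightarrow> real \<Rightarrow> real \<Rightarrow> bool" where
  "abel_equation_at R k x y \<longleftrightarrow>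
     (\<exists>I. has_improper_integral (\<lambda>s. s / sqrt (s\<^sup>2 - x\<^sup>2) * k s) x R I \<and> 2 * I = y)"

text \<open>All indices below are 1-based, as in \<open>r\<^sub>1, \<dots>, r\<^sub>n\<close>. On a mesh with
  \<open>r\<^sub>1 < \<dots> < r\<^sub>n\<close> the half-open cells are disjoint, so the sum takes the value \<open>k\<^sub>j\<close> on
  \<open>[r\<^sub>j, r\<^sub>j\<^sub>+\<^sub>1)\<close>; its value outside \<open>[r\<^sub>1, r\<^sub>n)\<close>, in particular
  at the single point \<open>r\<^sub>n\<close>, is a dummy 0 that does not affect the integrals.\<close>

definition left_step_function ::
  "nat \<Rightarrow> (nat \<Rightarrow> real) \<Rightarrow> (nat \<Rightarrow> real) \<Rightarrow> real \<Rightarrow> real" where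
  "left_step_function n r k s = (\<Sum>j = 1..n - 1. k j * indicator {r j..<r (j + 1)} s)"

text \<open>The last conjunct is linear extrapolation: an affine function passes through
  the points with indices \<open>n - 2\<close> and \<open>n - 1\<close>, and its value at \<open>r\<^sub>n\<close> is \<open>k\<^sub>n\<close>.\<close>

definition left_rectangle_solution ::
  "nat \<Rightarrow> real \<Rightarrow> (nat \<Rightarrow> real) \<Rightarrow> (nat \<Rightarrow> real) \<Rightarrow> (real \<Rightarrow> real) \<Rightarrow> (nat \<Rightarrow> real) \<Rightarrow> bool"
  where
  "left_rectangle_solution n R x r q k \<longleftrightarrow>
     (\<forall>i\<in>{1..n - 1}. abel_equation_at R (left_step_function n r k) (x i) (q (x i))) \<and>
     (\<exists>a b. k (n - 2) = a * r (n - 2) + b \<and>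
            k (n - 1) = a * r (n - 1) + b \<and>
            k n = a * r n + b)"

end

theory Submission
  imports Defs
begin

text \<open>The function \<open>sqrt (s\<^sup>2 - x\<^sup>2)\<close> is a primitive of the Abel kernel \<open>s / sqrt (s\<^sup>2 - x\<^sup>2)\<close> on
  \<open>s > x \<ge> 0\<close>, and it is continuous up to \<open>s = x\<close>. Against a step function the Abel integral
  is therefore elementary: the cell \<open>[r\<^sub>j, r\<^sub>j\<^sub>+\<^sub>1)\<close> contributes \<open>k\<^sub>j\<close> times the increment of
  this primitive over the part of the cell to the right of \<open>x\<close>. At a node \<open>x = r\<^sub>i\<close> the cells
  \<open>j < i\<close> contribute nothing and the cells \<open>j \<ge> i\<close> contribute \<open>p\<^sub>i\<^sub>j k\<^sub>j\<close>, so the Abel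
  equations at the nodes form an upper triangular linear system
  (\<open>abel_equation_left_step_at_node\<close>). Its diagonal entries \<open>p\<^sub>i\<^sub>i\<close> are positive because the
  mesh is nonnegative and strictly increasing, so each row is equivalent to a formula for
  \<open>k\<^sub>i\<close> in terms of the later values; this is the recursion.
  The extrapolation formula is the two-point form of the line through the last two
  values determined by the system (\<open>affine_extrapolation_iff\<close>).\<close>

lemma has_improper_integral_iff:
  assumes "a < b"
    and int: "\<And>c. a < c \<Longrightarrow> c < b \<Longrightarrow> (f has_integral F c) {c..b}"
    and lim: "(F \<longlongrightarrow> L) (at_right a)"
  shows "has_improper_integral f a b I \<longleftrightarrow> I = L"
proof -
  have "\<forall>\<^sub>F c in at_right a. F c = integral {c..b} f"
    using eventually_at_right_real[OF \<open>a < b\<close>]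
    by eventually_elim (auto dest: int[THEN integral_unique])
  with lim have conv: "((\<lambda>c. integral {c..b} f) \<longlongrightarrow> L) (at_right a)"
    by (rule Lim_transform_eventually)
  show ?thesis
    unfolding has_improper_integral_def
    using conv has_integral_integrable[OF int] tendsto_unique[OF trivial_limit_at_right_real conv, of I]
    by blast
qed

lemma abel_kernel_has_integral:
  fixes x a b :: real
  assumes "0 \<le> x" "x < a" "a \<le> b"
  shows "((\<lambda>s. s / sqrt (s\<^sup>2 - x\<^sup>2)) has_integral sqrt (b\<^sup>2 - x\<^sup>2) - sqrt (a\<^sup>2 - x\<^sup>2)) {a..b}"
proof (rule fundamental_theorem_of_calculus[OF \<open>a \<le> b\<close>])
  fix s assume "s \<in> {a..b}"
  with assms have "x\<^sup>2 < s\<^sup>2"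
    by (intro power_strict_mono) auto
  then have "((\<lambda>s. sqrt (s\<^sup>2 - x\<^sup>2)) has_real_derivative s / sqrt (s\<^sup>2 - x\<^sup>2)) (at s within {a..b})"
    by (auto intro!: derivative_eq_intros simp: field_simps)
  then show "((\<lambda>s. sqrt (s\<^sup>2 - x\<^sup>2)) has_vector_derivative s / sqrt (s\<^sup>2 - x\<^sup>2)) (at s within {a..b})"
    by (simp add: has_real_derivative_iff_has_vector_derivative)
qed

text \<open>Writing the ends of the truncated cell as \<open>max c a\<close> and \<open>max c b\<close> covers at once the
  cells to the left of \<open>c\<close>, containing \<open>c\<close> and to the right of \<open>c\<close>, and keeps the value
  continuous in \<open>c\<close>, which makes the limit towards the singularity immediate.\<close>

lemma abel_kernel_cell_has_integral:
  fixes x a b c R :: real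
  assumes "0 \<le> x" "x < c" "c \<le> R" "a \<le> b" "b \<le> R"
  shows "((\<lambda>s. s / sqrt (s\<^sup>2 - x\<^sup>2) * indicator {a..<b} s) has_integral
           sqrt ((max c b)\<^sup>2 - x\<^sup>2) - sqrt ((max c a)\<^sup>2 - x\<^sup>2)) {c..R}"
proof -
  let ?g = "\<lambda>s. s / sqrt (s\<^sup>2 - x\<^sup>2)"
  let ?I = "sqrt ((max c b)\<^sup>2 - x\<^sup>2) - sqrt ((max c a)\<^sup>2 - x\<^sup>2)"
  have "(?g has_integral ?I) {max c a..max c b}"
    using assms by (intro abel_kernel_has_integral) auto
  moreover have "{max c a..max c b} \<subseteq> {c..R}"
    using assms by auto
  ultimately have "((\<lambda>s. if s \<in> {max c a..max c b} then ?g s else 0) has_integral ?I) {c..R}"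
    by (simp only: has_integral_restrict)
  \<comment> \<open>The truncated closed cell and the half-open cell differ, within \<open>{c..R}\<close>, at most at the point \<open>max c b\<close>.\<close>
  then show ?thesis
    by (rule has_integral_spike_finite[where S = "{max c b}", rotated 2])
       (auto simp: indicator_def)
qed

lemma abel_equation_left_step_iff:
  fixes x R :: real
  assumes "0 \<le> x" "x < R"
    and mesh: "\<And>j. j \<in> {1..n - 1} \<Longrightarrow> r j \<le> r (j + 1) \<and> r (j + 1) \<le> R"
  shows "abel_equation_at R (left_step_function n r k) x y \<longleftrightarrow>
    2 * (\<Sum>j = 1..n - 1. k j * (sqrt ((max x (r (j + 1)))\<^sup>2 - x\<^sup>2) - sqrt ((max x (r j))\<^sup>2 - x\<^sup>2))) = y"
proof -
  let ?F = "\<lambda>c. \<Sum>j = 1..n - 1. k j * (sqrt ((max c (r (j + 1)))\<^sup>2 - x\<^sup>2) - sqrt ((max c (r j))\<^sup>2 - x\<^sup>2))"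
  let ?f = "\<lambda>s. s / sqrt (s\<^sup>2 - x\<^sup>2) * left_step_function n r k s"
  have int: "(?f has_integral ?F c) {c..R}" if "x < c" "c < R" for c
  proof -
    have "((\<lambda>s. \<Sum>j = 1..n - 1. k j * (s / sqrt (s\<^sup>2 - x\<^sup>2) * indicator {r j..<r (j + 1)} s))
        has_integral ?F c) {c..R}"
      using that assms
      by (intro has_integral_sum has_integral_mult_right abel_kernel_cell_has_integral) auto
    then show ?thesis
      unfolding left_step_function_def sum_distrib_left
      by (simp only: mult.left_commute)
  qed
  have lim: "(?F \<longlongrightarrow> ?F x) (at_right x)"
    by (intro tendsto_intros)
  have "has_improper_integral ?f x R I \<longleftrightarrow> I = ?F x" for I
    by (rule has_improper_integral_iff[OF \<open>x < R\<close> _ lim]) (rule int)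
  then show ?thesis
    unfolding abel_equation_at_def by (simp only: simp_thms ex_simps)
qed

lemma strict_mesh_less:
  fixes r :: "nat \<Rightarrow> real"
  assumes "\<And>i. 1 \<le> i \<Longrightarrow> i < n \<Longrightarrow> r i < r (i + 1)"
    and "1 \<le> i" "i < j" "j \<le> n"
  shows "r i < r j"
  using \<open>i < j\<close> \<open>j \<le> n\<close>
proof (induction j)
  case (Suc j)
  then show ?case
    using assms(1)[of j] \<open>1 \<le> i\<close> by (cases "i = j") auto
qed simp

text \<open>At a node \<open>r i\<close> the cells to its left collapse under \<open>max (r i)\<close>, which leaves one row of
  an upper triangular system.\<close>

lemma abel_equation_left_step_at_node:
  fixes r :: "nat \<Rightarrow> real"
  assumes mesh: "\<And>i. 1 \<le> i \<Longrightarrow> i < n \<Longrightarrow> r i < r (i + 1)"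
    and "0 \<le> r 1" and i: "i \<in> {1..n - 1}"
  shows "abel_equation_at (r n) (left_step_function n r k) (r i) y \<longleftrightarrow>
    (\<Sum>j = i..n - 1. (sqrt ((r (j + 1))\<^sup>2 - (r i)\<^sup>2) - sqrt ((r j)\<^sup>2 - (r i)\<^sup>2)) * k j) = y / 2"
proof -
  have less: "r a < r b" if "1 \<le> a" "a < b" "b \<le> n" for a b
    using strict_mesh_less[of n r a b] mesh that by blast
  have le: "r a \<le> r b" if "1 \<le> a" "a \<le> b" "b \<le> n" for a b
    using less[of a b] that by (cases "a = b") auto
  have "0 \<le> r i"
    by (rule order.trans[OF \<open>0 \<le> r 1\<close> le]) (use i in auto)
  moreover have "r i < r n"
    using less[of i n] i by auto
  moreover have "r j \<le> r (j + 1) \<and> r (j + 1) \<le> r n" if "j \<in> {1..n - 1}" for j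
    using that by (auto intro!: le)
  ultimately have "abel_equation_at (r n) (left_step_function n r k) (r i) y \<longleftrightarrow>
    2 * (\<Sum>j = 1..n - 1. k j * (sqrt ((max (r i) (r (j + 1)))\<^sup>2 - (r i)\<^sup>2)
                              - sqrt ((max (r i) (r j))\<^sup>2 - (r i)\<^sup>2))) = y"
    by (rule abel_equation_left_step_iff)
  also have "(\<Sum>j = 1..n - 1. k j * (sqrt ((max (r i) (r (j + 1)))\<^sup>2 - (r i)\<^sup>2)
                              - sqrt ((max (r i) (r j))\<^sup>2 - (r i)\<^sup>2)))
    = (\<Sum>j = i..n - 1. (sqrt ((r (j + 1))\<^sup>2 - (r i)\<^sup>2) - sqrt ((r j)\<^sup>2 - (r i)\<^sup>2)) * k j)"
  proof (rule sum.mono_neutral_cong_right)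
    show "\<forall>j\<in>{1..n - 1} - {i..n - 1}. k j * (sqrt ((max (r i) (r (j + 1)))\<^sup>2 - (r i)\<^sup>2)
                              - sqrt ((max (r i) (r j))\<^sup>2 - (r i)\<^sup>2)) = 0"
    proof
      fix j assume "j \<in> {1..n - 1} - {i..n - 1}"
      with i have "r j \<le> r i" "r (j + 1) \<le> r i"
        by (auto intro!: le)
      then show "k j * (sqrt ((max (r i) (r (j + 1)))\<^sup>2 - (r i)\<^sup>2)
                              - sqrt ((max (r i) (r j))\<^sup>2 - (r i)\<^sup>2)) = 0"
        by (simp add: max_absorb1)
    qed
  next
    fix j assume "j \<in> {i..n - 1}"
    with i have "r i \<le> r j" "r i \<le> r (j + 1)"
      by (auto intro!: le)
    then show "k j * (sqrt ((max (r i) (r (j + 1)))\<^sup>2 - (r i)\<^sup>2) - sqrt ((max (r i) (r j))\<^sup>2 - (r i)\<^sup>2))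
      = (sqrt ((r (j + 1))\<^sup>2 - (r i)\<^sup>2) - sqrt ((r j)\<^sup>2 - (r i)\<^sup>2)) * k j"
      by (simp add: max_absorb2)
  qed (use i in auto)
  finally show ?thesis
    by auto
qed

lemma affine_extrapolation_iff:
  fixes s t u v w z :: real
  assumes "s \<noteq> t"
  shows "(\<exists>a b. v = a * s + b \<and> w = a * t + b \<and> z = a * u + b) \<longleftrightarrow>
    z = v + ((u - s) / (t - s)) * (w - v)"
proof
  assume "\<exists>a b. v = a * s + b \<and> w = a * t + b \<and> z = a * u + b"
  then obtain a b where "v = a * s + b" "w = a * t + b" "z = a * u + b"
    by blast
  moreover from this have "w - v = a * (t - s)"
    by (simp add: algebra_simps)
  then have "((u - s) / (t - s)) * (w - v) = a * (u - s)"
    using assms by simp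
  ultimately show "z = v + ((u - s) / (t - s)) * (w - v)"
    by (simp add: algebra_simps)
next
  assume z: "z = v + ((u - s) / (t - s)) * (w - v)"
  define a where "a = (w - v) / (t - s)"
  have "a * (t - s) = w - v"
    using assms by (simp add: a_def)
  then have "v = a * s + (v - a * s)" "w = a * t + (v - a * s)"
    by (simp_all add: algebra_simps)
  moreover have "z = a * u + (v - a * s)"
    unfolding z a_def by (simp add: algebra_simps diff_divide_distrib)
  ultimately show "\<exists>a b. v = a * s + b \<and> w = a * t + b \<and> z = a * u + b"
    by blast
qed

theorem theorem2p1:
  fixes n :: nat and R :: real
    and x r :: "nat \<Rightarrow> real"
    and q :: "real \<Rightarrow> real"
    and k :: "nat \<Rightarrow> real"
    and p :: "nat \<Rightarrow> nat \<Rightarrow> real"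
  assumes "n \<ge> 3" and "R > 0"
    and "\<And>i. 1 \<le> i \<Longrightarrow> i \<le> n \<Longrightarrow> x i = r i"
    and "r 1 = 0" and "r n = R"
    and "\<And>i. 1 \<le> i \<Longrightarrow> i < n \<Longrightarrow> r i < r (i + 1)"
    and "\<And>i j. 1 \<le> i \<Longrightarrow> i \<le> j \<Longrightarrow> j \<le> n - 1 \<Longrightarrow>
           p i j = sqrt ((r (j + 1))\<^sup>2 - (x i)\<^sup>2) - sqrt ((r j)\<^sup>2 - (x i)\<^sup>2)"
  shows "left_rectangle_solution n R x r q k \<longleftrightarrow>
     k (n - 1) = (q (x (n - 1)) / 2) / p (n - 1) (n - 1) \<and>
     (\<forall>i\<in>{1..n - 2}. k i = (q (x i) / 2 - (\<Sum>j = i + 1..n - 1. p i j * k j)) / p i i) \<and>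
     k n = k (n - 2) + ((r n - r (n - 2)) / (r (n - 1) - r (n - 2))) * (k (n - 1) - k (n - 2))"
proof -
  note mesh = assms(6)
  have less: "r a < r b" if "1 \<le> a" "a < b" "b \<le> n" for a b
    using strict_mesh_less[of n r a b] mesh that by blast
  have row: "abel_equation_at R (left_step_function n r k) (x i) (q (x i)) \<longleftrightarrow>
      k i = (q (x i) / 2 - (\<Sum>j = i + 1..n - 1. p i j * k j)) / p i i"
    if i: "i \<in> {1..n - 1}" for i
  proof -
    have xi: "x i = r i"
      using assms(3) i by auto
    have "0 \<le> r i"
      using less[of 1 i] \<open>r 1 = 0\<close> i by (cases "i = 1") (auto intro: less_imp_le)
    moreover have "r i < r (i + 1)"
      using mesh i by auto
    ultimately have "(r i)\<^sup>2 < (r (i + 1))\<^sup>2"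
      by (intro power_strict_mono) auto
    then have diag: "p i i > 0"
      using assms(7)[of i i] i xi by auto
    have "abel_equation_at R (left_step_function n r k) (x i) (q (x i)) \<longleftrightarrow>
        (\<Sum>j = i..n - 1. p i j * k j) = q (x i) / 2"
    proof -
      have "(\<Sum>j = i..n - 1. (sqrt ((r (j + 1))\<^sup>2 - (r i)\<^sup>2) - sqrt ((r j)\<^sup>2 - (r i)\<^sup>2)) * k j)
        = (\<Sum>j = i..n - 1. p i j * k j)"
        using assms(7) i xi by (intro sum.cong) auto
      then show ?thesis
        using abel_equation_left_step_at_node[of n r i k "q (x i)"] mesh i \<open>r 1 = 0\<close> \<open>r n = R\<close> xi
        by simp
    qed
    also have "(\<Sum>j = i..n - 1. p i j * k j) = p i i * k i + (\<Sum>j = i + 1..n - 1. p i j * k j)"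
      using i by (simp add: sum.atLeast_Suc_atMost)
    finally show ?thesis
      using diag by (auto simp: field_simps)
  qed
  have "{1..n - 1} = insert (n - 1) {1..n - 2}"
    using \<open>n \<ge> 3\<close> by auto
  moreover have "r (n - 2) \<noteq> r (n - 1)"
    by (rule less_imp_neq[OF less]) (use \<open>n \<ge> 3\<close> in auto)
  moreover have "(\<Sum>j = (n - 1) + 1..n - 1. p (n - 1) j * k j) = 0"
    by simp
  ultimately show ?thesis
    unfolding left_rectangle_solution_def
    by (simp add: row affine_extrapolation_iff)
qed

end
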